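(* Let $(V,X,V^* )$ be a Gelfand triple, with continuous embedding $\mathcal{E}:V\to X$ and adjoint embedding $\mathcal{E}^*:X\to V^*$, and let $A:X\to Y$ be the forward operator. Assume that there is a constant $K>0$ such that $$\|Ax\|_Y \ge K\,\|\mathcal{E}^*x\|_{V^*}\qquad\text{for all } x\in X.$$ Then the range inclusion $V\subseteq \mathcal{R}(A^* )$ is valid. Hence, for any element $x^\dagger\in X$ and any orthonormal basis $\{u_k\}_{k\in\mathbb{N}}$ of $X$ such that $u_k\in V$ for all $k\in\operatorname{supp}(x^\dagger)$, for every $k\in\operatorname{supp}(x^\dagger)$ there exists $f_k\in Y^*$ such that $u_k=A^*f_k$.
   Context: $X$ is an infinite-dimensional separable real Hilbert space, $Y$ is a Banach space with dual $Y^*$, and $A:X\to Y$ is a bounded injective linear operator with non-closed range. Identifying $X$ with its dual, the adjoint $A^*:Y^*\to X$ is defined by $\langle f,Ax\rangle_{Y^*\times Y}=\langle A^*f,x\rangle_X$ for all $x\in X$, $f\in Y^*$; $\mathcal{R}(A^* )$ denotes its range. In the paper $x^\dagger$ is the unique solution of $Ax=y$ for a given $y\in\mathcal{R}(A)$. $(V,X,V^* )$ is called a Gelfand triple if $V$ is a separable linear subspace of $X$ with its own norm $\|\cdot\|_V$, dense in $X$, such that (1) the linear embedding $\mathcal{E}:V\to X$ is continuous, i.e. $\|\mathcal{E}v\|_X\le C\|v\|_V$ for all $v\in V$ with some constant $C>0$; (2) the duality pairing of $V$ and its dual space $V^*$ is compatible with $\langle\cdot,\cdot\rangle_X$ in the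 sense that $\langle x,v\rangle_{V^*\times V}=\langle x,v\rangle_X$ for all $x\in X$, $v\in V$, where $x\in X$ is regarded as an element of $V^*$ via the adjoint embedding $\mathcal{E}^*:X\to V^*$, so $\langle \mathcal{E}^*x,v\rangle_{V^*\times V}=\langle x,\mathcal{E}v\rangle_X$. For an orthonormal basis $\{u_k\}_{k\in\mathbb{N}}$ of $X$, $\operatorname{supp}(x)=\{k\in\mathbb{N}:\langle x,u_k\rangle_X\ne 0\}$. *)

theory Defs
  imports "HOL-Analysis.Analysis"
begin

definition infinite_dimensional :: "'a::real_vector itself \<Rightarrow> bool" where
  "infinite_dimensional _ \<longleftrightarrow> \<not> (\<exists>B :: 'a set. finite B \<and> span B = UNIV)"

definition orthonormal_basis :: "(nat \<Rightarrow> 'x::real_inner) \<Rightarrow> bool" where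
  "orthonormal_basis u \<longleftrightarrow>
     (\<forall>i j. u i \<bullet> u j = (if i = j then 1 else 0)) \<and> closure (span (range u)) = UNIV"

definition supp :: "(nat \<Rightarrow> 'x::real_inner) \<Rightarrow> 'x \<Rightarrow> nat set" where
  "supp u x = {k. x \<bullet> u k \<noteq> 0}"

text \<open>
  The adjoint \<open>A\<^sup>* : Y\<^sup>* \<rightarrow> X\<close> of an operator from a Hilbert space \<open>X\<close> (identified with its
  dual) to a Banach space \<open>Y\<close>. The description operator is well defined by the Riesz
  representation theorem, see \<open>dual_adjoint_pairing\<close> and \<open>dual_adjoint_eqI\<close> below.
\<close>

definition dual_adjoint ::
  "('x::{real_inner,complete_space} \<Rightarrow>\<^sub>L 'y::banach) \<Rightarrow> ('y \<Rightarrow>\<^sub>L real) \<Rightarrow> 'x" where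
  "dual_adjoint A f = (THE z. \<forall>x. blinfun_apply f (blinfun_apply A x) = z \<bullet> x)"

text \<open>
  The subspace \<open>V\<close> with its own norm is represented by a normed type \<open>'v\<close>, whose norm and
  dual space \<open>'v \<Rightarrow>\<^sub>L real\<close> are those of \<open>V\<close>, and an embedding \<open>E\<close> that is a linear
  isomorphism of \<open>'v\<close> onto the set \<open>V\<close>. No completeness of \<open>V\<close> is assumed. The last
  conjunct determines \<open>Es\<close> as the adjoint embedding \<open>X \<rightarrow> V\<^sup>*\<close>.
\<close>

definition gelfand_triple ::
  "'x::{real_inner,complete_space} set \<Rightarrow> ('v::real_normed_vector \<Rightarrow> 'x) \<Rightarrow>
     ('x \<Rightarrow> ('v \<Rightarrow>\<^sub>L real)) \<Rightarrow> bool" where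
  "gelfand_triple V E Es \<longleftrightarrow>
     subspace V \<and> linear E \<and> bij_betw E UNIV V \<and>
     separable_space (euclidean :: 'v topology) \<and>
     closure V = UNIV \<and>
     (\<exists>C>0. \<forall>v. norm (E v) \<le> C * norm v) \<and>
     (\<forall>x v. blinfun_apply (Es x) v = x \<bullet> E v)"

lemma riesz_representation:
  fixes f :: "'x::{real_inner,complete_space} \<Rightarrow> real"
  assumes f: "bounded_linear f"
  shows "\<exists>z. \<forall>x. f x = z \<bullet> x"
proof -
  interpret f: bounded_linear f by fact
  define J where "J x = x \<bullet> x - 2 * f x" for x
  obtain M where M: "\<And>x. norm (f x) \<le> norm x * M" using f.bounded by blast
  have lower: "- (M\<^sup>2) \<le> J x" for x
  proof -
    have "f x \<le> norm x * M" using M[of x] by simp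
    moreover have "0 \<le> (norm x - M)\<^sup>2" by simp
    ultimately show ?thesis
      unfolding J_def by (simp add: power2_diff dot_square_norm algebra_simps)
  qed
  define d where "d = Inf (range J)"
  have bdd: "bdd_below (range J)" using lower by (intro bdd_belowI[of _ "- (M\<^sup>2)"]) auto
  have d: "d \<le> J x" for x unfolding d_def by (rule cInf_lower) (use bdd in auto)
  have "\<exists>x. J x < d + inverse (real (Suc n))" for n
    using cInf_lessD[of "range J" "d + inverse (real (Suc n))"] unfolding d_def by auto
  then have "\<forall>n. \<exists>x. J x < d + inverse (real (Suc n))" by blast
  then obtain X where X: "\<And>n. J (X n) < d + inverse (real (Suc n))"
    by (rule choice[THEN exE]) blast
  have dist: "(norm (x - y))\<^sup>2 \<le> 2 * (J x - d) + 2 * (J y - d)" for x y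
  proof -
    define m where "m = (1/2) *\<^sub>R (x + y)"
    have "f m = (f x + f y) / 2" unfolding m_def by (simp add: f.add f.scaleR)
    moreover have "m \<bullet> m = (x \<bullet> x + 2 * (x \<bullet> y) + y \<bullet> y) / 4"
      unfolding m_def by (simp add: inner_add_left inner_add_right inner_commute)
    moreover have "(norm (x - y))\<^sup>2 = x \<bullet> x - 2 * (x \<bullet> y) + y \<bullet> y"
      unfolding power2_norm_eq_inner
      by (simp add: inner_diff_left inner_diff_right inner_commute)
    ultimately have "(norm (x - y))\<^sup>2 = 2 * J x + 2 * J y - 4 * J m"
      unfolding J_def by simp
    moreover have "d \<le> J m" by (rule d)
    ultimately show ?thesis by simp
  qed
  have "Cauchy X"
  proof (rule CauchyI)
    fix e :: real assume e: "0 < e"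
    then obtain N where N: "inverse (real (Suc N)) < e\<^sup>2 / 4"
      using reals_Archimedean[of "e\<^sup>2 / 4"] by auto
    have "norm (X m - X n) < e" if "m \<ge> N" "n \<ge> N" for m n
    proof -
      have "J (X k) - d < e\<^sup>2 / 4" if "k \<ge> N" for k
      proof -
        have "J (X k) < d + inverse (real (Suc k))" by (rule X)
        also have "\<dots> \<le> d + inverse (real (Suc N))"
          using that by (intro add_left_mono le_imp_inverse_le) auto
        also have "\<dots> < d + e\<^sup>2 / 4" using N by (rule add_strict_left_mono)
        finally show ?thesis by simp
      qed
      from this[OF that(1)] this[OF that(2)] dist[of "X m" "X n"]
      have "(norm (X m - X n))\<^sup>2 < e\<^sup>2" by simp
      then show ?thesis using e by (simp add: power_less_imp_less_base)
    qed
    then show "\<exists>M. \<forall>m\<ge>M. \<forall>n\<ge>M. norm (X m - X n) < e" by blast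
  qed
  then have "convergent X" by (rule Cauchy_convergent)
  then obtain z where z: "X \<longlonglongrightarrow> z" unfolding convergent_def by (rule exE)
  have "(\<lambda>n. J (X n)) \<longlonglongrightarrow> J z"
    unfolding J_def by (intro tendsto_intros f.tendsto z)
  moreover have "(\<lambda>n. d + inverse (real (Suc n))) \<longlonglongrightarrow> d"
    using tendsto_add[OF tendsto_const LIMSEQ_inverse_real_of_nat] by simp
  ultimately have "J z \<le> d"
    by (rule LIMSEQ_le) (auto intro!: exI[of _ 0] less_imp_le X simp del: of_nat_Suc)
  then have min: "J z \<le> J x" for x using d[of x] by linarith
  have "f h = z \<bullet> h" for h
  proof -
    define a where "a = z \<bullet> h - f h"
    define s where "s = 1 + h \<bullet> h"
    have s: "s > 0" "h \<bullet> h = s - 1" by (simp_all add: s_def add_pos_nonneg)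
    have J: "J (z + t *\<^sub>R h) = J z + 2 * t * a + t\<^sup>2 * (h \<bullet> h)" for t
    proof -
      have "(z + t *\<^sub>R h) \<bullet> (z + t *\<^sub>R h) = z \<bullet> z + 2 * t * (z \<bullet> h) + t\<^sup>2 * (h \<bullet> h)"
        by (simp add: inner_add_left inner_add_right inner_commute[of h z]
            distrib_left power2_eq_square)
      then show ?thesis
        unfolding J_def a_def by (simp add: f.add f.scaleR right_diff_distrib)
    qed
    have "0 \<le> 2 * (- a / s) * a + (- a / s)\<^sup>2 * (s - 1)"
      using J[of "- a / s"] min[of "z + (- a / s) *\<^sub>R h"] s(2) by simp
    also have "\<dots> = - (a\<^sup>2 * (s + 1) / s\<^sup>2)"
      using s(1) by (simp add: divide_simps) (simp add: algebra_simps power2_eq_square)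
    finally have "a\<^sup>2 * (s + 1) / s\<^sup>2 \<le> 0" by simp
    then have "a\<^sup>2 * (s + 1) \<le> 0" using s(1) by (simp add: divide_le_0_iff)
    then have "a = 0" using s(1) by (simp add: mult_le_0_iff)
    then show ?thesis unfolding a_def by simp
  qed
  then show ?thesis by blast
qed

lemma dual_adjoint_eqI:
  assumes "\<And>x. blinfun_apply f (blinfun_apply A x) = z \<bullet> x"
  shows "dual_adjoint A f = z"
  unfolding dual_adjoint_def
proof (rule the_equality)
  show "\<forall>x. blinfun_apply f (blinfun_apply A x) = z \<bullet> x" using assms by blast
  fix w assume "\<forall>x. blinfun_apply f (blinfun_apply A x) = w \<bullet> x"
  then have "\<forall>x. w \<bullet> x = z \<bullet> x" using assms by simp
  then show "w = z" by (rule vector_eq_rdot[THEN iffD1])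
qed

lemma dual_adjoint_pairing:
  "blinfun_apply f (blinfun_apply A x) = dual_adjoint A f \<bullet> x"
proof -
  have "bounded_linear (\<lambda>x. blinfun_apply f (blinfun_apply A x))"
    by (intro bounded_linear_intros)
  then obtain z where "\<forall>x. blinfun_apply f (blinfun_apply A x) = z \<bullet> x"
    using riesz_representation by blast
  then show ?thesis using dual_adjoint_eqI[of f A z] by simp
qed

end

theory Submission
  imports Defs
begin

text \<open>
  For \<open>v\<close> in \<open>V\<close> the functional \<open>A x \<mapsto> \<langle>x, v\<rangle>\<close> on \<open>\<R>(A)\<close> is bounded by \<open>(\<parallel>v\<parallel>\<^sub>V / K) \<parallel>A x\<parallel>\<close>,
  because \<open>\<bar>\<langle>x, v\<rangle>\<bar> \<le> \<parallel>\<E>\<^sup>* x\<parallel> \<parallel>v\<parallel>\<^sub>V\<close>. A Hahn-Banach extension \<open>f\<close> of it to \<open>Y\<close> satisfies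
  \<open>A\<^sup>* f = v\<close>. The Hahn-Banach theorem itself comes from two facts: a minimal sublinear
  functional is linear, and a linear functional on a subspace dominated by a sublinear \<open>p\<close>
  is encoded in a sublinear functional below \<open>p\<close>.
\<close>

section \<open>Sublinear functionals\<close>

text \<open>Homogeneity is asked only as an inequality for positive factors, which is what one can
  check directly for an infimum. Scaling back by \<open>inverse t\<close> turns it into an equality,
  and the value 0 at 0 follows.\<close>

definition sublinear :: "('a::real_vector \<Rightarrow> real) \<Rightarrow> bool" where
  "sublinear q \<longleftrightarrow> (\<forall>x y. q (x + y) \<le> q x + q y) \<and> (\<forall>t>0. \<forall>x. q (t *\<^sub>R x) \<le> t * q x)"

lemma sublinear_add: "sublinear q \<Longrightarrow> q (x + y) \<le> q x + q y"
  by (simp add: sublinear_def)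

lemma sublinear_scaleR_le: "sublinear q \<Longrightarrow> t > 0 \<Longrightarrow> q (t *\<^sub>R x) \<le> t * q x"
  by (simp add: sublinear_def)

lemma sublinear_scaleR:
  assumes "sublinear q" "t > 0"
  shows "q (t *\<^sub>R x) = t * q x"
proof (rule antisym)
  have "q (inverse t *\<^sub>R (t *\<^sub>R x)) \<le> inverse t * q (t *\<^sub>R x)"
    using assms by (intro sublinear_scaleR_le) auto
  then show "t * q x \<le> q (t *\<^sub>R x)"
    using assms(2) by (simp add: field_simps)
qed (rule sublinear_scaleR_le[OF assms])

lemma sublinear_zero: "sublinear q \<Longrightarrow> q 0 = 0"
  using sublinear_scaleR[of q 2 0] by simp

lemma sublinear_minus: "sublinear q \<Longrightarrow> - q (- x) \<le> q x"
  using sublinear_add[of q x "- x"] sublinear_zero[of q] by simp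

text \<open>
  Taking \<open>x = - a\<close> shows the use of \<open>G\<close>: a pair \<open>(a, c) \<in> G\<close> imposes \<open>r (- a) \<le> c\<close>.
\<close>

lemma sublinear_cone_reduction:
  fixes q :: "'a::real_vector \<Rightarrow> real"
  assumes q: "sublinear q"
    and zero: "(0, 0) \<in> G"
    and add: "\<And>a c b d. (a, c) \<in> G \<Longrightarrow> (b, d) \<in> G \<Longrightarrow> (a + b, c + d) \<in> G"
    and scale: "\<And>t a c. t > 0 \<Longrightarrow> (a, c) \<in> G \<Longrightarrow> (t *\<^sub>R a, t * c) \<in> G"
    and nonneg: "\<And>a c. (a, c) \<in> G \<Longrightarrow> 0 \<le> q a + c"
  obtains r where "sublinear r" "r \<le> q" "\<And>x a c. (a, c) \<in> G \<Longrightarrow> r x \<le> q (x + a) + c"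
proof -
  define F where "F x = (\<lambda>(a, c). q (x + a) + c)" for x
  define r where "r x = Inf (F x ` G)" for x
  \<comment> \<open>Subadditivity gives \<open>q a \<le> q (x + a) + q (- x)\<close>, and
    \<open>nonneg\<close> bounds \<open>q a\<close> from below by \<open>- c\<close>. The resulting
    bound does not depend on the pair, so the infimum \<open>r x\<close> is a genuine one.\<close>
  have "- q (- x) \<le> F x g" if "g \<in> G" for x g
    using that nonneg[of "fst g" "snd g"] sublinear_add[OF q, of "x + fst g" "- x"]
    by (auto simp: F_def split: prod.splits)
  then have bdd: "bdd_below (F x ` G)" for x
    by (intro bdd_belowI[of _ "- q (- x)"]) auto
  have lower: "r x \<le> q (x + a) + c" if "(a, c) \<in> G" for x a c
    using cInf_lower[OF imageI[OF that, of "F x"] bdd] by (simp add: r_def F_def)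
  have greatest: "z \<le> r x" if "\<And>a c. (a, c) \<in> G \<Longrightarrow> z \<le> q (x + a) + c" for x z
    unfolding r_def using zero that by (intro cInf_greatest) (auto simp: F_def)
  have "r (x + y) \<le> r x + r y" for x y
  proof -
    \<comment> \<open>The two infima are taken one after the other: first over \<open>(a, c)\<close>
      with \<open>(b, d)\<close> fixed, then over \<open>(b, d)\<close>.\<close>
    have "r (x + y) - (q (y + b) + d) \<le> r x" if bd: "(b, d) \<in> G" for b d
    proof (rule greatest)
      fix a c assume "(a, c) \<in> G"
      then show "r (x + y) - (q (y + b) + d) \<le> q (x + a) + c"
        using lower[OF add[OF _ bd], of a c "x + y"] sublinear_add[OF q, of "x + a" "y + b"]
        by (simp add: algebra_simps)
    qed
    then have "r (x + y) - r x \<le> r y"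
      by (intro greatest) (simp add: algebra_simps)
    then show ?thesis by simp
  qed
  moreover have "r (t *\<^sub>R x) \<le> t * r x" if t: "t > 0" for t x
  proof -
    have "r (t *\<^sub>R x) / t \<le> r x"
    proof (rule greatest)
      fix a c assume "(a, c) \<in> G"
      then show "r (t *\<^sub>R x) / t \<le> q (x + a) + c"
        using lower[OF scale[OF t], of a c "t *\<^sub>R x"] sublinear_scaleR[OF q t, of "x + a"] t
        by (simp add: scaleR_add_right field_simps)
    qed
    then show ?thesis using t by (simp add: field_simps)
  qed
  ultimately have "sublinear r" by (simp add: sublinear_def)
  moreover have "r \<le> q" using lower[OF zero] by (simp add: le_fun_def)
  ultimately show thesis using lower by (rule that)
qed

section \<open>Minimal sublinear functionals and the Hahn-Banach theorem\<close>

text \<open>Cone reduction along a single direction \<open>a\<close> yields a sublinear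
  \<open>r \<le> q\<close> with \<open>r x \<le> q (x + a) - q a\<close>. Minimality forces
  \<open>r = q\<close>, so \<open>q\<close> is superadditive as well as subadditive.\<close>

lemma minimal_sublinear_linear:
  fixes q :: "'a::real_vector \<Rightarrow> real"
  assumes q: "sublinear q"
    and minimal: "\<And>r. sublinear r \<Longrightarrow> r \<le> q \<Longrightarrow> r = q"
  shows "linear q"
proof -
  have "q x + q a \<le> q (x + a)" for x a
  proof -
    \<comment> \<open>The ray spanned by \<open>(a, - q a)\<close>; on it the condition
      \<open>nonneg\<close> holds with equality, by positive homogeneity.\<close>
    define G where "G = (\<lambda>t. (t *\<^sub>R a, - t * q a)) ` {0..}"
    obtain r where r: "sublinear r" "r \<le> q" "\<And>x a c. (a, c) \<in> G \<Longrightarrow> r x \<le> q (x + a) + c"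
    proof (rule sublinear_cone_reduction[OF q, of G])
      show "(0, 0) \<in> G" unfolding G_def by (rule image_eqI[of _ _ 0]) auto
      show "(b + b', c + c') \<in> G" if bc: "(b, c) \<in> G" "(b', c') \<in> G" for b c b' c'
      proof -
        from bc obtain s t where "0 \<le> s" "0 \<le> t"
          "b = s *\<^sub>R a" "c = - s * q a" "b' = t *\<^sub>R a" "c' = - t * q a"
          unfolding G_def by auto
        then show ?thesis
          unfolding G_def by (intro image_eqI[of _ _ "s + t"]) (auto simp: algebra_simps)
      qed
      show "(t *\<^sub>R b, t * c) \<in> G" if "t > 0" and bc: "(b, c) \<in> G" for t b c
      proof -
        from bc obtain s where "0 \<le> s" "b = s *\<^sub>R a" "c = - s * q a"
          unfolding G_def by auto
        then show ?thesis
          using \<open>t > 0\<close> unfolding G_def by (intro image_eqI[of _ _ "t * s"]) auto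
      qed
      show "0 \<le> q b + c" if "(b, c) \<in> G" for b c
      proof -
        from that obtain s where s: "0 \<le> s" "b = s *\<^sub>R a" "c = - s * q a"
          unfolding G_def by auto
        show ?thesis
          using s sublinear_scaleR[OF q, of s a] sublinear_zero[OF q] by (cases "s = 0") auto
      qed
    qed blast
    have "(a, - q a) \<in> G" unfolding G_def by (rule image_eqI[of _ _ 1]) auto
    then have "r x \<le> q (x + a) - q a" using r(3)[of a "- q a" x] by simp
    then show ?thesis using minimal[OF r(1,2)] by simp
  qed
  then have add: "q (x + y) = q x + q y" for x y
    using sublinear_add[OF q, of x y] by (auto intro: antisym)
  have minus: "q (- x) = - q x" for x
    using add[of x "- x"] sublinear_zero[OF q] by simp
  have "q (t *\<^sub>R x) = t * q x" for t x
  proof (cases t "0 :: real" rule: linorder_cases)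
    case less
    then show ?thesis using sublinear_scaleR[OF q, of "- t" x] minus[of "t *\<^sub>R x"] by simp
  qed (use sublinear_zero[OF q] sublinear_scaleR[OF q] in auto)
  with add show ?thesis by (intro linearI) auto
qed

text \<open>Zorn's lemma for the sublinear functionals below \<open>p\<close>: the pointwise infimum
  of a nonempty chain is again one of them.\<close>

lemma exists_minimal_sublinear:
  fixes p :: "'a::real_vector \<Rightarrow> real"
  assumes p: "sublinear p"
  obtains q where "sublinear q" "q \<le> p" "\<And>r. sublinear r \<Longrightarrow> r \<le> q \<Longrightarrow> r = q"
proof -
  define S where "S = {q. sublinear q \<and> q \<le> p}"
  have "\<exists>m\<in>S. \<forall>r\<in>S. r \<le> m \<longrightarrow> r = m"
  proof (rule predicate_Zorn)
    \<comment> \<open>The order is reversed, so that a maximal element is a minimal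
      functional.\<close>
    show "partial_order_on S (relation_of (\<lambda>f g. g \<le> f) S)"
      by (rule partial_order_on_relation_ofI) auto
    fix C assume "C \<in> Chains (relation_of (\<lambda>f g. g \<le> f) S)"
    then have C: "C \<subseteq> S" "\<And>f g. f \<in> C \<Longrightarrow> g \<in> C \<Longrightarrow> f \<le> g \<or> g \<le> f"
      unfolding Chains_def relation_of_def by blast+
    show "\<exists>u\<in>S. \<forall>f\<in>C. u \<le> f"
    proof (cases "C = {}")
      case True
      then show ?thesis using p by (auto simp: S_def)
    next
      case False
      define u where "u x = (INF f\<in>C. f x)" for x
      have sub: "sublinear f" "f \<le> p" if "f \<in> C" for f using C(1) that by (auto simp: S_def)
      \<comment> \<open>Uniform over the chain, since
        \<open>- p (- x) \<le> - f (- x) \<le> f x\<close>; this keeps the infimum finite.\<close>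
      have "- p (- x) \<le> f x" if "f \<in> C" for f x
        using sublinear_minus[OF sub(1)[OF that], of x] le_funD[OF sub(2)[OF that], of "- x"]
        by linarith
      then have "bdd_below ((\<lambda>f. f x) ` C)" for x
        by (intro bdd_belowI[of _ "- p (- x)"]) auto
      then have lower: "u x \<le> f x" if "f \<in> C" for f x
        unfolding u_def using that by (rule cINF_lower)
      have greatest: "z \<le> u x" if "\<And>f. f \<in> C \<Longrightarrow> z \<le> f x" for x z
        unfolding u_def using False that by (rule cINF_greatest)
      have "u (x + y) \<le> u x + u y" for x y
      proof -
        have "u (x + y) - g y \<le> u x" if g: "g \<in> C" for g
        proof (rule greatest)
          fix f assume f: "f \<in> C"
          \<comment> \<open>Comparability supplies one member below both \<open>f\<close> and
            \<open>g\<close>, whence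
            \<open>u (x + y) \<le> h (x + y) \<le> h x + h y \<le> f x + g y\<close>.\<close>
          from C(2)[OF f g] obtain h where h: "h \<in> C" "h \<le> f" "h \<le> g" using f g by blast
          show "u (x + y) - g y \<le> f x"
            using lower[OF h(1), of "x + y"] sublinear_add[OF sub(1)[OF h(1)], of x y]
              le_funD[OF h(2), of x] le_funD[OF h(3), of y] by linarith
        qed
        then have "u (x + y) - u x \<le> u y"
          by (intro greatest) (simp add: algebra_simps)
        then show ?thesis by simp
      qed
      moreover have "u (t *\<^sub>R x) \<le> t * u x" if t: "t > 0" for t x
      proof -
        have "u (t *\<^sub>R x) / t \<le> u x"
        proof (rule greatest)
          fix f assume f: "f \<in> C"
          show "u (t *\<^sub>R x) / t \<le> f x"
            using lower[OF f, of "t *\<^sub>R x"] sublinear_scaleR[OF sub(1)[OF f] t, of x] t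
            by (simp add: field_simps)
        qed
        then show ?thesis using t by (simp add: field_simps)
      qed
      ultimately have "sublinear u" by (simp add: sublinear_def)
      moreover have "u \<le> p"
        using False lower sub(2) by (meson all_not_in_conv le_funI order_trans)
      ultimately show ?thesis
        using lower by (auto simp: S_def le_fun_def)
    qed
  qed
  then obtain m where "m \<in> S" "\<forall>r\<in>S. r \<le> m \<longrightarrow> r = m" by blast
  then show thesis
    by (intro that[of m]) (auto simp: S_def intro: order_trans)
qed

text \<open>Cone reduction with the graph of \<open>- f\<close> over \<open>S\<close> gives a
  sublinear \<open>r\<close> below \<open>p\<close> that is at most \<open>f\<close> on
  \<open>S\<close>; here \<open>nonneg\<close> is the domination of \<open>f\<close> by
  \<open>p\<close>. A minimal \<open>g \<le> r\<close> is linear, and \<open>g \<le> f\<close> at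
  both \<open>x\<close> and \<open>- x\<close> yields equality on \<open>S\<close>.\<close>

lemma hahn_banach_sublinear:
  fixes f p :: "'a::real_vector \<Rightarrow> real"
  assumes p: "sublinear p" and S: "subspace S"
    and add: "\<And>x y. x \<in> S \<Longrightarrow> y \<in> S \<Longrightarrow> f (x + y) = f x + f y"
    and scale: "\<And>t x. x \<in> S \<Longrightarrow> f (t *\<^sub>R x) = t * f x"
    and le: "\<And>x. x \<in> S \<Longrightarrow> f x \<le> p x"
  obtains g where "linear g" "\<And>x. x \<in> S \<Longrightarrow> g x = f x" "g \<le> p"
proof -
  define G where "G = (\<lambda>s. (s, - f s)) ` S"
  obtain r where r: "sublinear r" "r \<le> p" "\<And>x a c. (a, c) \<in> G \<Longrightarrow> r x \<le> p (x + a) + c"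
  proof (rule sublinear_cone_reduction[OF p, of G])
    show "(0, 0) \<in> G"
      using subspace_0[OF S] scale[of 0 0] by (auto simp: G_def)
    show "(a + b, c + d) \<in> G" if "(a, c) \<in> G" "(b, d) \<in> G" for a c b d
      using that add by (auto simp: G_def subspace_add[OF S])
    show "(t *\<^sub>R a, t * c) \<in> G" if "t > 0" "(a, c) \<in> G" for t a c
      using that scale by (auto simp: G_def subspace_scale[OF S])
    show "0 \<le> p a + c" if "(a, c) \<in> G" for a c
      using that le by (auto simp: G_def)
  qed blast
  obtain g where g: "sublinear g" "g \<le> r" "\<And>q. sublinear q \<Longrightarrow> q \<le> g \<Longrightarrow> q = g"
    using exists_minimal_sublinear[OF r(1)] by blast
  have lin: "linear g" using g(1,3) by (rule minimal_sublinear_linear)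
  have upper: "g x \<le> f x" if "x \<in> S" for x
  proof -
    \<comment> \<open>This pair, applied at \<open>x\<close>, gives
      \<open>r x \<le> p 0 + f x\<close>.\<close>
    have "(- x, f x) \<in> G"
      using that scale[OF that, of "-1"] subspace_neg[OF S that] by (auto simp: G_def)
    then show ?thesis
      using r(3)[of "- x" "f x" x] le_funD[OF g(2), of x] sublinear_zero[OF p] by simp
  qed
  have "g x = f x" if "x \<in> S" for x
    using upper[OF that] upper[OF subspace_neg[OF S that]] scale[OF that, of "-1"]
      linear_neg[OF lin, of x] by simp
  then show thesis using that[OF lin] order_trans[OF g(2) r(2)] by blast
qed

section \<open>Range of the adjoint\<close>

lemma in_range_dual_adjointI:
  fixes A :: "'x::{real_inner,complete_space} \<Rightarrow>\<^sub>L 'y::banach"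
  assumes bound: "\<And>x. \<bar>z \<bullet> x\<bar> \<le> M * norm (blinfun_apply A x)"
  shows "z \<in> range (dual_adjoint A)"
proof -
  \<comment> \<open>Any preimage serves: two preimages of \<open>y\<close> differ by an element of
    the kernel of \<open>A\<close>, on which the bound makes \<open>z\<close> vanish.\<close>
  define \<phi> where "\<phi> y = z \<bullet> (SOME x. blinfun_apply A x = y)" for y
  have \<phi>: "\<phi> (blinfun_apply A x) = z \<bullet> x" for x
  proof -
    define x' where "x' = (SOME x'. blinfun_apply A x' = blinfun_apply A x)"
    have "blinfun_apply A x' = blinfun_apply A x"
      unfolding x'_def by (rule someI) (rule refl)
    then have "z \<bullet> (x' - x) = 0" using bound[of "x' - x"] by (simp add: blinfun.diff_right)
    then show ?thesis by (simp add: \<phi>_def x'_def inner_diff_right)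
  qed
  \<comment> \<open>The absolute value makes the factor nonnegative, as subadditivity of
    \<open>p\<close> requires, whatever the sign of \<open>M\<close>.\<close>
  define p where "p y = \<bar>M\<bar> * norm y" for y :: 'y
  have "sublinear p"
    unfolding sublinear_def p_def
    using mult_left_mono[OF norm_triangle_ineq, of "\<bar>M\<bar>"] by (auto simp: distrib_left)
  moreover have "subspace (range (blinfun_apply A))"
    by (intro linear_subspace_image bounded_linear.linear blinfun.bounded_linear_right subspace_UNIV)
  ultimately obtain g where g: "linear g" "g \<le> p"
    and ext: "\<And>y. y \<in> range (blinfun_apply A) \<Longrightarrow> g y = \<phi> y"
  proof (rule hahn_banach_sublinear[of p "range (blinfun_apply A)" \<phi>])
    fix y y' assume "y \<in> range (blinfun_apply A)" "y' \<in> range (blinfun_apply A)"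
    then obtain x x' where "y = blinfun_apply A x" "y' = blinfun_apply A x'" by blast
    then show "\<phi> (y + y') = \<phi> y + \<phi> y'"
      using \<phi>[of "x + x'"] by (simp add: \<phi> blinfun.add_right inner_add_right)
  next
    fix t y assume "y \<in> range (blinfun_apply A)"
    then obtain x where "y = blinfun_apply A x" by blast
    then show "\<phi> (t *\<^sub>R y) = t * \<phi> y"
      using \<phi>[of "t *\<^sub>R x"] by (simp add: \<phi> blinfun.scaleR_right)
  next
    fix y assume "y \<in> range (blinfun_apply A)"
    then obtain x where y: "y = blinfun_apply A x" by blast
    have "z \<bullet> x \<le> M * norm (blinfun_apply A x)" using bound[of x] by linarith
    also have "\<dots> \<le> \<bar>M\<bar> * norm (blinfun_apply A x)" by (intro mult_right_mono) auto
    finally show "\<phi> y \<le> p y" by (simp add: y \<phi> p_def)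
  qed blast
  \<comment> \<open>Domination by the even functional \<open>p\<close> at \<open>y\<close> and
    \<open>- y\<close> bounds \<open>g\<close> on both sides, so the extension is
    continuous.\<close>
  have "\<bar>g y\<bar> \<le> norm y * \<bar>M\<bar>" for y
    using le_funD[OF g(2), of y] le_funD[OF g(2), of "- y"] linear_neg[OF g(1), of y]
    by (simp add: p_def mult.commute)
  then have "bounded_linear g"
    using g(1) by (intro bounded_linear.intro bounded_linear_axioms.intro) auto
  then have "blinfun_apply (Blinfun g) (blinfun_apply A x) = z \<bullet> x" for x
    by (simp add: bounded_linear_Blinfun_apply ext \<phi>)
  then have "dual_adjoint A (Blinfun g) = z" by (rule dual_adjoint_eqI)
  then show ?thesis by blast
qed

theorem proposition3:
  fixes A :: "'x::{real_inner,complete_space} \<Rightarrow>\<^sub>L 'y::banach"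
    and V :: "'x set"
    and E :: "'v::real_normed_vector \<Rightarrow> 'x"
    and Es :: "'x \<Rightarrow> ('v \<Rightarrow>\<^sub>L real)"
    and K :: real
  assumes "infinite_dimensional TYPE('x)"
    and "separable_space (euclidean :: 'x topology)"
    and "inj (blinfun_apply A)"
    and "\<not> closed (range (blinfun_apply A))"
    and "gelfand_triple V E Es"
    and "K > 0"
    and "\<And>x. norm (blinfun_apply A x) \<ge> K * norm (Es x)"
  shows "V \<subseteq> range (dual_adjoint A) \<and>
    (\<forall>(xd :: 'x) (u :: nat \<Rightarrow> 'x).
       orthonormal_basis u \<longrightarrow> (\<forall>k\<in>supp u xd. u k \<in> V) \<longrightarrow>
       (\<forall>k\<in>supp u xd. \<exists>f :: 'y \<Rightarrow>\<^sub>L real. u k = dual_adjoint A f))"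
proof -
  have "V \<subseteq> range (dual_adjoint A)"
  proof
    fix z assume "z \<in> V"
    then obtain v where v: "z = E v"
      using assms(5) unfolding gelfand_triple_def bij_betw_def by blast
    have pairing: "blinfun_apply (Es x) v = x \<bullet> z" for x
      using assms(5) unfolding gelfand_triple_def v by blast
    have "\<bar>z \<bullet> x\<bar> \<le> (norm v / K) * norm (blinfun_apply A x)" for x
    proof -
      have "\<bar>z \<bullet> x\<bar> \<le> norm (Es x) * norm v"
        using norm_blinfun[of "Es x" v] by (simp add: pairing inner_commute)
      also have "\<dots> \<le> (norm (blinfun_apply A x) / K) * norm v"
        using assms(6) assms(7)[of x] by (intro mult_right_mono) (auto simp: field_simps)
      finally show ?thesis by (simp add: mult.commute)
    qed
    then show "z \<in> range (dual_adjoint A)" by (rule in_range_dual_adjointI)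
  qed
  \<comment> \<open>The claim about bases is an instance of the inclusion, since the relevant
    \<open>u k\<close> lie in \<open>V\<close>.\<close>
  then show ?thesis by blast
qed

end
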